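(* Fix any $1\le i\le\mathfrak n$ and $m\in M^{(i)}$, and let $\lambda^{(j)}:=\lambda(V^{(j)}(m))$ for $j=1,\dots,i$. Then $\lambda^{(1)}\le\dots\le\lambda^{(i)}$.
   Context: **Setting.** $\mathcal S$ is a finite set and $E:\mathcal S\to\mathbb R$ satisfies $E(r)\neq E(s)$ for $r\ne s$. For each $\beta>0$, $X=(X_n)_{n\ge0}$ is a Markov chain on $\mathcal S$ with transition matrix $\mathbf P=(p(r,s))_{r,s\in\mathcal S}$ (depending on $\beta$) and stationary distribution $\pi$ such that: (i) the chain is irreducible, $p(s,s)>0$, $p(r,s)>0\iff p(s,r)>0$, and the set of pairs with $p(r,s)>0$ does not depend on $\beta$; (ii) there are $\gamma_\beta>0$ with $\gamma_\beta\to0$, $\beta\gamma_\beta\to\infty$ as $\beta\to\infty$ and $e^{-\beta((E(s)-E(r))^++\gamma_\beta/|\mathcal S|)}\le p(r,s)\le e^{-\beta((E(s)-E(r))^+-\gamma_\beta/|\mathcal S|)}$ for all distinct $r,s$ with $p(r,s)>0$; (iii) $p^*(r,s):=\lim_{\beta\to\infty}p(r,s)$ exists for all $r,s$ and, for pairs with $p(r,s)>0$, is positive if $E(r)\ge E(s)$ and $0$ otherwise; (iv) $\pi(r)p(r,s)=\pi(s)p(s,r)$. Distinct states $r,s$ are neighbours, $r\sim s$, if $p(r,s)>0$. **Eigenvalue.** For a valley $V$ (valleys are connected), $\lambda(V)$ is the Perron–Frobenius (maximal) eigenvalue of the nonnegative irreducible matrix $(p(r,s))_{r,s\in V}$. It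 is also the probability of staying in $V$ at least one step when the chain is started with the quasi-stationary distribution $\nu$ on $V$, i.e. the distribution with $\mathbb P_\nu(X_n=j\mid\tau_{\mathcal S\setminus V}>n)=\nu(j)$ for all $j\in V$, where $\tau_A=\inf\{n\ge1:X_n\in A\}$. **Essential saddles.** For $r\neq s$, $\Gamma(r,s)$ is the set of self-avoiding paths $(\gamma_0,\dots,\gamma_k)$ with $\gamma_0=r$, $\gamma_k=s$, $p(\gamma_l,\gamma_{l+1})>0$. A path in $\Gamma(r,s)$ is minimal if its maximal energy $\max_l E(\gamma_l)$ is minimal within $\Gamma(r,s)$. The essential saddle $z^*(r,s)$ is the state of maximal energy on any minimal path from $r$ to $s$ (well defined since $E$ is injective); $z^*(s,s):=s$. **Metastable states.** $M^{(1)}:=\{s: E(s)<E(r)\text{ for all }r\sim s\}$ is the set of local minima, and $\mathcal S=M^{(0)}\supset M^{(1)}\supset\dots\supset M^{(\mathfrak n)}=\{s_0\}$ is the filtration into metastable states constructed by Scoppola for Markov chains with exponentially small transition probabilities. It starts with $M^{(1)}$ and deletes one local minimum at each step, namely the one with minimal activation energy for a transition to another minimum, the activation energy from $s$ to $m$ being $I(s,m)=\inf_{\gamma\in\Gamma(s,m)}\sum_{l\ge1}(E(\gamma_l)-E(\gamma_{l-1}))^+$ (the elements of the sets $M^{(i)}$ arise from the local minima of $E$ or of certain modifications of it). The local minima are labelled $m^{(1)},\dots,m^{(\mathfrak n)}$ so that $M^{(i)}=\{m^{(i)},\dots,m^{(\mathfrak n)}\}$ for $1\le i\le\mathfrak n$.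 **Attraction.** For $m\in M^{(i)}$, $V^{(i)}_<(m):=\{s: E(z^*(s,m))<E(z^*(s,m'))\ \forall m'\in M^{(i)}\setminus\{m\}\}$. State $s$ is attracted by $m$ at level $i$ ($s\leadsto m$ at level $i$) if $E(z^*(s,m))=\min_{n\in M^{(i)}}E(z^*(s,n))$ and every minimal path from $s$ to any $m'\in M^{(i)}\setminus\{m\}$ with $E(z^*(s,m'))=E(z^*(s,m))$ hits $V^{(i)}_<(m)$. Let $l(i):=\inf\{j: i<j\le\mathfrak n,\ m^{(i)}\leadsto m\text{ at level }j\text{ for some }m\in M^{(j)}\}$ ($\inf\emptyset=\infty$). **Valleys.** $V^{(1)}(m):=\{s: s\leadsto m\text{ at level }1\}$ for $m\in M^{(1)}$, $N^{(1)}:=(\bigcup_{j=1}^{\mathfrak n}V^{(1)}(m^{(j)}))^c$. For $2\le i\le\mathfrak n$, $m\in M^{(i)}$: $V^{(i)}(m):=V^{(i-1)}(m)\cup\{s\in N^{(i-1)}: s\leadsto m\text{ at level }i\}\cup\bigcup_{j:\,l(j)=i,\ m^{(j)}\leadsto m\text{ at level }i}V^{(j)}(m^{(j)})$, and $N^{(i)}:=(\bigcup_{j=1}^{\mathfrak n}V^{(i\wedge j)}(m^{(j)}))^c$, where $i\wedge j=\min(i,j)$. *)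

theory Defs
  imports Complex_Main "HOL-Library.Extended_Nat"
begin

text \<open>The principal submatrix of \<open>A\<close> with rows and columns in \<open>V\<close> is kept indexed by \<open>V\<close>;
  only the values of the vector \<open>v\<close> on \<open>V\<close> matter.\<close>

definition eigenvalue_on :: "('s \<Rightarrow> 's \<Rightarrow> real) \<Rightarrow> 's set \<Rightarrow> complex \<Rightarrow> bool" where
  "eigenvalue_on A V \<mu> \<longleftrightarrow>
    (\<exists>v :: 's \<Rightarrow> complex. (\<exists>r\<in>V. v r \<noteq> 0) \<and>
       (\<forall>r\<in>V. (\<Sum>s\<in>V. complex_of_real (A r s) * v s) = \<mu> * v r))"

text \<open>The real eigenvalue dominating the moduli of all complex eigenvalues. There is at most one
  such number; for nonnegative matrices it exists by the Perron-Frobenius theorem.\<close>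

definition perron_eigenvalue :: "('s \<Rightarrow> 's \<Rightarrow> real) \<Rightarrow> 's set \<Rightarrow> real" where
  "perron_eigenvalue A V =
    (THE x. eigenvalue_on A V (complex_of_real x) \<and>
            (\<forall>\<mu>. eigenvalue_on A V \<mu> \<longrightarrow> cmod \<mu> \<le> x))"

text \<open>The state space is the finite type \<open>'s\<close>. The transition matrix \<open>p \<beta>\<close> and the stationary
  distribution \<open>\<pi> \<beta>\<close> are constrained for \<open>\<beta> > 0\<close> only.\<close>

locale metastable_chain =
  fixes E :: "'s::finite \<Rightarrow> real"
    and p :: "real \<Rightarrow> 's \<Rightarrow> 's \<Rightarrow> real"
    and \<pi> :: "real \<Rightarrow> 's \<Rightarrow> real"
  assumes inj_E: "inj E"
    and p_nonneg: "\<And>\<beta> r s. \<beta> > 0 \<Longrightarrow> p \<beta> r s \<ge> 0"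
    and p_row_sum: "\<And>\<beta> r. \<beta> > 0 \<Longrightarrow> (\<Sum>s\<in>UNIV. p \<beta> r s) = 1"
    and \<pi>_nonneg: "\<And>\<beta> s. \<beta> > 0 \<Longrightarrow> \<pi> \<beta> s \<ge> 0"
    and \<pi>_sum: "\<And>\<beta>. \<beta> > 0 \<Longrightarrow> (\<Sum>s\<in>UNIV. \<pi> \<beta> s) = 1"
    and stationary: "\<And>\<beta> s. \<beta> > 0 \<Longrightarrow> (\<Sum>r\<in>UNIV. \<pi> \<beta> r * p \<beta> r s) = \<pi> \<beta> s"
    and irreducible: "\<And>\<beta> r s. \<beta> > 0 \<Longrightarrow> (\<lambda>x y. p \<beta> x y > 0)\<^sup>*\<^sup>* r s"
    and diag_pos: "\<And>\<beta> s. \<beta> > 0 \<Longrightarrow> p \<beta> s s > 0"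
    and support_sym: "\<And>\<beta> r s. \<beta> > 0 \<Longrightarrow> p \<beta> r s > 0 \<longleftrightarrow> p \<beta> s r > 0"
    and support_const:
      "\<And>\<beta> \<beta>' r s. \<beta> > 0 \<Longrightarrow> \<beta>' > 0 \<Longrightarrow> p \<beta> r s > 0 \<longleftrightarrow> p \<beta>' r s > 0"
    and exponential_rates:
      "\<exists>\<gamma> :: real \<Rightarrow> real.
         (\<forall>\<beta>>0. \<gamma> \<beta> > 0) \<and> (\<gamma> \<longlongrightarrow> 0) at_top \<and>
         filterlim (\<lambda>\<beta>. \<beta> * \<gamma> \<beta>) at_top at_top \<and>
         (\<forall>\<beta>>0. \<forall>r s. r \<noteq> s \<and> p \<beta> r s > 0 \<longrightarrow>
            exp (- \<beta> * (max 0 (E s - E r) + \<gamma> \<beta> / real (card (UNIV :: 's set)))) \<le> p \<beta> r s \<and>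
            p \<beta> r s \<le> exp (- \<beta> * (max 0 (E s - E r) - \<gamma> \<beta> / real (card (UNIV :: 's set)))))"
    and limits:
      "\<And>r s. \<exists>q. ((\<lambda>\<beta>. p \<beta> r s) \<longlongrightarrow> q) at_top \<and>
               ((\<forall>\<beta>>0. p \<beta> r s > 0) \<longrightarrow> (if E r \<ge> E s then q > 0 else q = 0))"
    and reversible: "\<And>\<beta> r s. \<beta> > 0 \<Longrightarrow> \<pi> \<beta> r * p \<beta> r s = \<pi> \<beta> s * p \<beta> s r"
begin

text \<open>By \<open>support_const\<close> the quantifier over \<open>\<beta>\<close> could equally be existential.\<close>

definition edge :: "'s \<Rightarrow> 's \<Rightarrow> bool" where
  "edge r s \<longleftrightarrow> (\<forall>\<beta>>0. p \<beta> r s > 0)"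

definition neighbour :: "'s \<Rightarrow> 's \<Rightarrow> bool" where
  "neighbour r s \<longleftrightarrow> r \<noteq> s \<and> edge r s"

definition local_minima :: "'s set" where
  "local_minima = {s. \<forall>r. neighbour r s \<longrightarrow> E s < E r}"

definition paths :: "'s \<Rightarrow> 's \<Rightarrow> 's list set" where
  "paths r s = {\<gamma>. \<gamma> \<noteq> [] \<and> distinct \<gamma> \<and> hd \<gamma> = r \<and> last \<gamma> = s \<and> successively edge \<gamma>}"

definition max_energy :: "'s list \<Rightarrow> real" where
  "max_energy \<gamma> = Max (E ` set \<gamma>)"

definition minimal_path :: "'s \<Rightarrow> 's \<Rightarrow> 's list \<Rightarrow> bool" where
  "minimal_path r s \<gamma> \<longleftrightarrow> \<gamma> \<in> paths r s \<and> (\<forall>\<gamma>'\<in>paths r s. max_energy \<gamma> \<le> max_energy \<gamma>')"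

text \<open>Since \<open>E\<close> is injective and all minimal paths have the same maximal energy, the state
  described below does not depend on the minimal path.\<close>

definition essential_saddle :: "'s \<Rightarrow> 's \<Rightarrow> 's" where
  "essential_saddle r s =
    (if r = s then s
     else THE z. \<exists>\<gamma>. minimal_path r s \<gamma> \<and> z \<in> set \<gamma> \<and> E z = max_energy \<gamma>)"

definition activation_energy :: "'s \<Rightarrow> 's \<Rightarrow> real" where
  "activation_energy s m =
    (INF \<gamma>\<in>paths s m. \<Sum>l\<in>{1..<length \<gamma>}. max 0 (E (\<gamma> ! l) - E (\<gamma> ! (l - 1))))"

end

text \<open>A filtration into metastable states is given by a labelling \<open>lab 1, \<dots>, lab n\<close> of the local
  minima in order of deletion: \<open>lab i\<close> minimises, among the minima \<open>lab i, \<dots>, lab n\<close> left at step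
  \<open>i\<close>, the least activation energy needed to reach another one of them. In case of ties any
  minimiser may be deleted.\<close>

locale metastable_filtration = metastable_chain E p \<pi>
  for E :: "'s::finite \<Rightarrow> real"
    and p :: "real \<Rightarrow> 's \<Rightarrow> 's \<Rightarrow> real"
    and \<pi> :: "real \<Rightarrow> 's \<Rightarrow> real" +
  fixes n :: nat and lab :: "nat \<Rightarrow> 's"
  assumes lab_bij: "bij_betw lab {1..n} local_minima"
    and deletion_order:
      "\<And>i s. 1 \<le> i \<Longrightarrow> i < n \<Longrightarrow> s \<in> lab ` {i..n} \<Longrightarrow>
         Min (activation_energy (lab i) ` (lab ` {i..n} - {lab i}))
           \<le> Min (activation_energy s ` (lab ` {i..n} - {s}))"
begin

text \<open>Meaningful for levels \<open>1 \<le> i \<le> n\<close>.\<close>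

definition metastable_states :: "nat \<Rightarrow> 's set" where
  "metastable_states i = lab ` {i..n}"

definition strict_valley :: "nat \<Rightarrow> 's \<Rightarrow> 's set" where
  "strict_valley i m =
    {s. \<forall>m'\<in>metastable_states i - {m}. E (essential_saddle s m) < E (essential_saddle s m')}"

definition attracted :: "nat \<Rightarrow> 's \<Rightarrow> 's \<Rightarrow> bool" where
  "attracted i s m \<longleftrightarrow>
     E (essential_saddle s m) = Min ((\<lambda>m'. E (essential_saddle s m')) ` metastable_states i) \<and>
     (\<forall>m'\<in>metastable_states i - {m}. E (essential_saddle s m') = E (essential_saddle s m) \<longrightarrow>
        (\<forall>\<gamma>. minimal_path s m' \<gamma> \<longrightarrow> set \<gamma> \<inter> strict_valley i m \<noteq> {}))"

definition absorption_level :: "nat \<Rightarrow> enat" where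
  "absorption_level i =
    Inf (enat ` {j. i < j \<and> j \<le> n \<and> (\<exists>m\<in>metastable_states j. attracted j (lab i) m)})"

text \<open>\<open>valley i m\<close> is meaningful for \<open>1 \<le> i \<le> n\<close> and \<open>m \<in> metastable_states i\<close>, and
  \<open>non_valley i\<close> (the states in no valley at level \<open>i\<close>) for \<open>1 \<le> i \<le> n\<close>; the value at level
  \<open>0\<close> is a dummy. The bound \<open>j < i\<close> in the last union is implied by \<open>absorption_level j = i\<close>; it
  makes the recursion visibly well-founded.\<close>

function valley :: "nat \<Rightarrow> 's \<Rightarrow> 's set" and non_valley :: "nat \<Rightarrow> 's set" where
  "valley i m =
    (if i = 0 then {}
     else if i = 1 then {s. attracted 1 s m}
     else valley (i - 1) m
          \<union> {s \<in> non_valley (i - 1). attracted i s m}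
          \<union> (\<Union>j\<in>{j \<in> {1..<i}. absorption_level j = enat i \<and> attracted i (lab j) m}.
               valley j (lab j)))"
| "non_valley i = - (\<Union>j\<in>{1..n}. valley (min i j) (lab j))"
  by pat_completeness auto
termination
  by (relation "measure (\<lambda>x. case x of Inl (i, m) \<Rightarrow> 2 * i | Inr i \<Rightarrow> 2 * i + 1)") auto

declare valley.simps [simp del] non_valley.simps [simp del]

end

end

theory Submission
  imports Defs "HOL-Analysis.Analysis"
begin

text \<open>By detailed balance the matrix \<open>p \<beta>\<close> is self-adjoint for the inner product weighted by the
  stationary distribution, which is positive by irreducibility. For a self-adjoint matrix the maximum
  \<open>l\<close> of the Rayleigh quotient over the vectors supported in \<open>V\<close> is an eigenvalue of the submatrix
  on \<open>V\<close> (lemma \<open>rayleigh_maximizer\<close>). Since the entries are nonnegative, replacing a complex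
  eigenvector by its entrywise modulus shows that \<open>l\<close> dominates the modulus of every eigenvalue;
  so \<open>l\<close> is the Perron eigenvalue (lemma \<open>perron_eigenvalue_eqI\<close>). Thus reversibility reduces the spectral
  question to a variational one.

  A larger set gives the Rayleigh quotient more vectors to range over, hence a larger maximum: the
  Perron eigenvalue is monotone in the set, as long as the smaller one is nonempty (lemma
  \<open>perron_eigenvalue_mono\<close>). The valleys of \<open>m\<close> grow with the level by their very recursion, and the
  first of them contains \<open>m\<close>, because every path that leaves a local minimum has to climb (lemma
  \<open>local_minimum_in_valley\<close>).\<close>

section \<open>Perron eigenvalues of symmetrizable matrices\<close>

locale symmetrizable_nonneg =
  fixes A :: "'s::finite \<Rightarrow> 's \<Rightarrow> real" and w :: "'s \<Rightarrow> real"
  assumes A_nonneg: "A r s \<ge> 0"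
    and w_pos: "w r > 0"
    and balance: "w r * A r s = w s * A s r"
begin

text \<open>The form \<open>\<langle>x, A y\<rangle>\<close> on the vectors supported in \<open>V\<close>, for the inner product \<open>\<langle>x, y\<rangle>\<close> with
  weights \<open>w\<close>; detailed balance makes it symmetric.\<close>

definition matrix_form :: "'s set \<Rightarrow> ('s \<Rightarrow> real) \<Rightarrow> ('s \<Rightarrow> real) \<Rightarrow> real" where
  "matrix_form V x y = (\<Sum>r\<in>V. \<Sum>s\<in>V. w r * A r s * x r * y s)"

definition weighted_product :: "'s set \<Rightarrow> ('s \<Rightarrow> real) \<Rightarrow> ('s \<Rightarrow> real) \<Rightarrow> real" where
  "weighted_product V x y = (\<Sum>r\<in>V. w r * x r * y r)"

lemma matrix_form_sym: "matrix_form V x y = matrix_form V y x"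
proof -
  have "matrix_form V x y = (\<Sum>s\<in>V. \<Sum>r\<in>V. w r * A r s * x r * y s)"
    unfolding matrix_form_def by (rule sum.swap)
  also have "\<dots> = matrix_form V y x"
    unfolding matrix_form_def
    by (intro sum.cong refl) (metis balance mult.assoc mult.commute)
  finally show ?thesis .
qed

lemma matrix_form_alt:
  "matrix_form V x y = (\<Sum>r\<in>V. w r * x r * (\<Sum>s\<in>V. A r s * y s))"
  unfolding matrix_form_def by (simp add: sum_distrib_left mult_ac)

lemma weighted_product_pos:
  assumes "r \<in> V" "x r \<noteq> 0"
  shows "weighted_product V x x > 0"
  unfolding weighted_product_def
proof (rule sum_pos2[OF _ assms(1)])
  show "0 < w r * x r * x r"
    using assms(2) w_pos[of r] by (simp add: mult.assoc zero_less_mult_iff) (metis linorder_cases)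
  show "0 \<le> w q * x q * x q" for q
    using w_pos[of q] by (simp add: mult.assoc)
qed simp

lemma eigenvector_rayleigh:
  assumes "\<And>r. r \<in> V \<Longrightarrow> (\<Sum>s\<in>V. A r s * x s) = l * x r"
  shows "matrix_form V x x = l * weighted_product V x x"
proof -
  have "matrix_form V x x = (\<Sum>r\<in>V. w r * x r * (l * x r))"
    unfolding matrix_form_alt by (intro sum.cong refl) (simp add: assms)
  then show ?thesis
    by (simp add: weighted_product_def sum_distrib_left mult_ac)
qed

text \<open>A maximizer exists because the quotient is homogeneous of degree \<open>0\<close>, so that it may be
  restricted to the compact unit sphere. With the maximum \<open>l\<close>, the form \<open>l \<langle>y, y\<rangle> - \<langle>y, A y\<rangle>\<close> is
  positive semidefinite and vanishes at the maximizer, so its first variation vanishes there,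
  which is the eigenvalue equation.\<close>

lemma rayleigh_maximizer:
  assumes "V \<noteq> {}"
  obtains l x r where
    "r \<in> V" "x r \<noteq> 0"
    "\<And>r. r \<in> V \<Longrightarrow> (\<Sum>s\<in>V. A r s * x s) = l * x r"
    "\<And>y. matrix_form V y y \<le> l * weighted_product V y y"
proof -
  define K :: "(real^'s) set" where "K = sphere 0 1 \<inter> (\<Inter>s\<in>-V. {v. v $ s = 0})"
  define D where "D = (\<lambda>x. matrix_form V x x)"
  define N where "N = (\<lambda>x. weighted_product V x x)"
  have N_pos: "N (($) v) > 0" if "v \<in> K" for v
  proof -
    have "\<exists>s\<in>V. v $ s \<noteq> 0"
    proof (rule ccontr)
      assume "\<not> ?thesis"
      then have "v = 0"
        using that by (auto simp: K_def vec_eq_iff)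
      then show False
        using that by (simp add: K_def)
    qed
    then show ?thesis
      unfolding N_def using weighted_product_pos by blast
  qed
  have closed: "closed (\<Inter>s\<in>-V. {v :: real^'s. v $ s = 0})"
    by (intro closed_INT ballI closed_Collect_eq continuous_intros)
  have "compact K"
    unfolding K_def by (intro compact_Int_closed closed) simp
  moreover have "K \<noteq> {}"
  proof -
    obtain r where "r \<in> V"
      using assms by blast
    then have "axis r 1 \<in> K"
      by (auto simp: K_def axis_def norm_axis_1[unfolded axis_def])
    then show ?thesis
      by blast
  qed
  moreover have "continuous_on K (\<lambda>v. D (($) v) / N (($) v))"
    unfolding D_def matrix_form_def N_def weighted_product_def
    by (intro continuous_intros)
      (use N_pos in \<open>force simp: N_def weighted_product_def\<close>)
  ultimately obtain u where u: "u \<in> K"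
    "\<And>v. v \<in> K \<Longrightarrow> D (($) v) / N (($) v) \<le> D (($) u) / N (($) u)"
    using continuous_attains_sup[of K "\<lambda>v. D (($) v) / N (($) v)"] by blast
  define x where "x = ($) u"
  define l where "l = D x / N x"
  have D_x: "D x = l * N x"
    using N_pos[OF u(1)] by (simp add: l_def x_def)
  have rayleigh: "D y \<le> l * N y" for y
  proof (cases "\<exists>r\<in>V. y r \<noteq> 0")
    case False
    then have "D y = 0" "N y = 0"
      by (simp_all add: D_def N_def matrix_form_def weighted_product_def)
    then show ?thesis
      by simp
  next
    case True
    define z :: "real^'s" where "z = (\<chi> s. if s \<in> V then y s else 0)"
    have "z \<noteq> 0"
      using True by (auto simp: z_def vec_eq_iff)
    define v where "v = z /\<^sub>R norm z"
    have "norm v = 1"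
      using \<open>z \<noteq> 0\<close> by (simp add: v_def)
    then have "v \<in> K"
      by (auto simp: K_def v_def z_def)
    have scale: "D (($) v) = (inverse (norm z))\<^sup>2 * D y" "N (($) v) = (inverse (norm z))\<^sup>2 * N y"
      unfolding D_def N_def matrix_form_def weighted_product_def sum_distrib_left
      by (auto simp: v_def z_def power2_eq_square mult_ac intro!: sum.cong)
    have "D (($) v) \<le> l * N (($) v)"
      using u(2)[OF \<open>v \<in> K\<close>] N_pos[OF \<open>v \<in> K\<close>] by (simp add: l_def x_def pos_divide_le_eq)
    then show ?thesis
      using \<open>z \<noteq> 0\<close> unfolding scale by (simp add: mult.left_commute)
  qed
  have eigen: "(\<Sum>s\<in>V. A r s * x s) = l * x r" if "r \<in> V" for r
  proof -
    define e :: "'s \<Rightarrow> real" where "e = (\<lambda>s. if s = r then 1 else 0)"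
    define b where "b = w r * (l * x r - (\<Sum>s\<in>V. A r s * x s))"
    define c where "c = l * N e - D e"
    have cross: "l * weighted_product V e x - matrix_form V e x = b"
      using that
      by (simp add: matrix_form_alt weighted_product_def e_def b_def if_distrib if_distribR
          right_diff_distrib cong: if_cong)
    have variation: "0 \<le> 2 * t * b + t\<^sup>2 * c" for t
    proof -
      define y where "y = (\<lambda>s. x s + t * e s)"
      have "N y = N x + 2 * t * weighted_product V e x + t\<^sup>2 * N e"
        unfolding N_def weighted_product_def y_def sum_distrib_left sum.distrib[symmetric]
        by (intro sum.cong refl) (simp add: algebra_simps power2_eq_square)
      moreover have "D y = D x + t * matrix_form V x e + t * matrix_form V e x
          + t\<^sup>2 * D e"
        unfolding D_def matrix_form_def y_def sum_distrib_left sum.distrib[symmetric]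
        by (intro sum.cong refl) (simp add: algebra_simps power2_eq_square)
      ultimately have "l * N y - D y = 2 * t * b + t\<^sup>2 * c"
        by (simp add: D_x matrix_form_sym[of V x e] cross[symmetric] c_def algebra_simps)
      then show ?thesis
        using rayleigh[of y] by simp
    qed
    have "b = 0"
    proof (rule ccontr)
      assume "b \<noteq> 0"
      define d where "d = \<bar>c\<bar> + 1"
      have "d > 0" "c < d"
        by (simp_all add: d_def)
      \<comment> \<open>A step against \<open>b\<close> short enough for the linear term to beat the quadratic one.\<close>
      have "0 \<le> 2 * (- b / d) * b + (- b / d)\<^sup>2 * c"
        by (rule variation)
      also have "\<dots> = b\<^sup>2 / d * (c / d - 2)"
        using \<open>d > 0\<close> by (simp add: power2_eq_square field_simps)
      also have "\<dots> < 0"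
      proof (rule mult_pos_neg)
        show "0 < b\<^sup>2 / d"
          using \<open>b \<noteq> 0\<close> \<open>d > 0\<close> by simp
        show "c / d - 2 < 0"
          using \<open>d > 0\<close> \<open>c < d\<close> by (simp add: pos_divide_less_eq)
      qed
      finally show False
        by simp
    qed
    then show ?thesis
      using w_pos[of r] by (simp add: b_def)
  qed
  have "\<exists>r\<in>V. x r \<noteq> 0"
  proof (rule ccontr)
    assume "\<not> ?thesis"
    then have "N x = 0"
      by (simp add: N_def weighted_product_def)
    then show False
      using N_pos[OF u(1)] by (simp add: x_def)
  qed
  then show ?thesis
    using that eigen rayleigh unfolding D_def N_def by blast
qed

text \<open>A complex eigenvector \<open>v\<close> satisfies \<open>|\<mu>| |v r| \<le> (\<Sum>s\<in>V. A r s |v s|)\<close> because the entries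
  are nonnegative; so the Rayleigh quotient of \<open>|v|\<close> is at least \<open>|\<mu>|\<close>.\<close>

lemma perron_eigenvalue_eqI:
  assumes r0: "r0 \<in> V" "x r0 \<noteq> 0"
    and eigen: "\<And>r. r \<in> V \<Longrightarrow> (\<Sum>s\<in>V. A r s * x s) = l * x r"
    and rayleigh: "\<And>y. matrix_form V y y \<le> l * weighted_product V y y"
  shows "perron_eigenvalue A V = l"
proof -
  have ev: "eigenvalue_on A V (complex_of_real l)"
    unfolding eigenvalue_on_def
  proof (intro exI[of _ "\<lambda>r. complex_of_real (x r)"] conjI ballI)
    show "\<exists>r\<in>V. complex_of_real (x r) \<noteq> 0"
      using r0 by auto
    show "(\<Sum>s\<in>V. complex_of_real (A r s) * complex_of_real (x s))
        = complex_of_real l * complex_of_real (x r)" if "r \<in> V" for r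
      using arg_cong[OF eigen[OF that], of complex_of_real] by simp
  qed
  have dominant: "cmod \<mu> \<le> l" if \<mu>: "eigenvalue_on A V \<mu>" for \<mu>
  proof -
    obtain v r where r: "r \<in> V" "v r \<noteq> 0"
      and v: "\<And>r. r \<in> V \<Longrightarrow> (\<Sum>s\<in>V. complex_of_real (A r s) * v s) = \<mu> * v r"
      using \<mu> unfolding eigenvalue_on_def by blast
    define y where "y = (\<lambda>s. cmod (v s))"
    have sub: "cmod \<mu> * y q \<le> (\<Sum>s\<in>V. A q s * y s)" if "q \<in> V" for q
    proof -
      have "cmod \<mu> * y q = cmod (\<Sum>s\<in>V. complex_of_real (A q s) * v s)"
        by (simp add: v[OF that] y_def norm_mult)
      also have "\<dots> \<le> (\<Sum>s\<in>V. cmod (complex_of_real (A q s) * v s))"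
        by (rule norm_sum)
      also have "\<dots> = (\<Sum>s\<in>V. A q s * y s)"
        by (simp add: norm_mult y_def A_nonneg)
      finally show ?thesis .
    qed
    have "cmod \<mu> * weighted_product V y y = (\<Sum>q\<in>V. w q * y q * (cmod \<mu> * y q))"
      by (simp add: weighted_product_def sum_distrib_left mult_ac)
    also have "\<dots> \<le> matrix_form V y y"
      unfolding matrix_form_alt
      using w_pos by (intro sum_mono mult_left_mono sub) (simp_all add: y_def less_imp_le)
    also have "\<dots> \<le> l * weighted_product V y y"
      by (rule rayleigh)
    finally show ?thesis
      using weighted_product_pos[of r V y] r by (simp add: y_def)
  qed
  show ?thesis
    unfolding perron_eigenvalue_def
  proof (rule the_equality)
    fix x'
    assume x': "eigenvalue_on A V (complex_of_real x')
      \<and> (\<forall>\<mu>. eigenvalue_on A V \<mu> \<longrightarrow> cmod \<mu> \<le> x')"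
    have "cmod (complex_of_real l) \<le> x'" "cmod (complex_of_real x') \<le> l"
      using x' ev dominant by blast+
    then show "x' = l"
      by simp
  qed (use ev dominant in blast)
qed

text \<open>The maximizer for \<open>V\<close>, extended by zero, competes in the Rayleigh quotient for \<open>W\<close>.\<close>

lemma perron_eigenvalue_mono:
  assumes "V \<noteq> {}" "V \<subseteq> W"
  shows "perron_eigenvalue A V \<le> perron_eigenvalue A W"
proof -
  obtain l x r where V: "r \<in> V" "x r \<noteq> 0"
    "\<And>r. r \<in> V \<Longrightarrow> (\<Sum>s\<in>V. A r s * x s) = l * x r"
    "\<And>y. matrix_form V y y \<le> l * weighted_product V y y"
    using rayleigh_maximizer[OF assms(1)] by metis
  have "W \<noteq> {}"
    using assms by blast
  obtain l' x' r' where W: "r' \<in> W" "x' r' \<noteq> 0"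
    "\<And>r. r \<in> W \<Longrightarrow> (\<Sum>s\<in>W. A r s * x' s) = l' * x' r"
    "\<And>y. matrix_form W y y \<le> l' * weighted_product W y y"
    using rayleigh_maximizer[OF \<open>W \<noteq> {}\<close>] by metis
  define y where "y = (\<lambda>s. if s \<in> V then x s else 0)"
  have restrict: "(\<Sum>s\<in>W. f s) = (\<Sum>s\<in>V. f s)" if "\<And>s. s \<notin> V \<Longrightarrow> f s = 0" for f :: "'s \<Rightarrow> real"
    using assms(2) that by (intro sum.mono_neutral_right) auto
  have D: "matrix_form W y y = matrix_form V x x"
    unfolding matrix_form_def by (simp add: restrict y_def)
  have N: "weighted_product W y y = weighted_product V x x"
    unfolding weighted_product_def by (simp add: restrict y_def)
  have "l * weighted_product V x x \<le> l' * weighted_product V x x"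
    using W(4)[of y] eigenvector_rayleigh[OF V(3)] unfolding D N by simp
  then have "l \<le> l'"
    using weighted_product_pos[of r V x] V(1,2) by simp
  then show ?thesis
    using perron_eigenvalue_eqI[where x = x, OF V] perron_eigenvalue_eqI[where x = x', OF W] by simp
qed

end

section \<open>Reversibility\<close>

context metastable_chain
begin

text \<open>Detailed balance passes positivity from a state to its neighbours, and some state has
  positive weight.\<close>

lemma stationary_pos:
  assumes "\<beta> > 0"
  shows "\<pi> \<beta> s > 0"
proof -
  obtain r where r: "\<pi> \<beta> r > 0"
  proof -
    have "\<exists>r. \<pi> \<beta> r \<noteq> 0"
      using \<pi>_sum[OF assms] by (metis sum.neutral zero_neq_one)
    then show thesis
      using \<pi>_nonneg[OF assms] that by (metis less_eq_real_def)
  qed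
  from irreducible[OF assms, of r s] show ?thesis
  proof (induction rule: rtranclp_induct)
    case base
    show ?case by (fact r)
  next
    case (step y z)
    have "0 < \<pi> \<beta> z * p \<beta> z y"
      using step by (simp flip: reversible[OF assms, of y z])
    then show ?case
      using p_nonneg[OF assms, of z y] by (simp add: zero_less_mult_iff)
  qed
qed

lemma symmetrizable_transitions:
  assumes "\<beta> > 0"
  shows "symmetrizable_nonneg (p \<beta>) (\<pi> \<beta>)"
  using p_nonneg[OF assms] stationary_pos[OF assms] reversible[OF assms]
  by (rule symmetrizable_nonneg.intro)

section \<open>Essential saddles and local minima\<close>

lemma edge_iff: "edge r s \<longleftrightarrow> p 1 r s > 0"
proof
  assume "p 1 r s > 0"
  then show "edge r s"
    unfolding edge_def using support_const[of 1 _ r s] by simp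
qed (simp add: edge_def)

lemma paths_nonempty: "paths r s \<noteq> {}"
proof -
  have "(\<lambda>x y. p 1 x y > 0)\<^sup>*\<^sup>* r s"
    by (rule irreducible) simp
  then show ?thesis
  proof (induction rule: rtranclp_induct)
    case base
    have "[r] \<in> paths r r"
      by (simp add: paths_def)
    then show ?case
      by blast
  next
    case (step y z)
    obtain \<gamma> where \<gamma>: "\<gamma> \<in> paths r y"
      using step.IH by blast
    show ?case
    proof (cases "z \<in> set \<gamma>")
      case True
      \<comment> \<open>The path is cut at \<open>z\<close>, which keeps it self-avoiding.\<close>
      then obtain us vs where "\<gamma> = us @ z # vs"
        by (meson split_list)
      then have "us @ [z] \<in> paths r z"
        using \<gamma> by (cases us) (auto simp: paths_def hd_append successively_append_iff successively_Cons)
      then show ?thesis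
        by blast
    next
      case False
      then have "\<gamma> @ [z] \<in> paths r z"
        using \<gamma> step.hyps by (auto simp: paths_def successively_append_iff edge_iff)
      then show ?thesis
        by blast
    qed
  qed
qed

lemma minimal_path_exists: "\<exists>\<gamma>. minimal_path r s \<gamma>"
proof -
  have "max_energy \<gamma> \<in> range E" if "\<gamma> \<in> paths r s" for \<gamma>
  proof -
    have "Max (E ` set \<gamma>) \<in> E ` set \<gamma>"
      using that by (intro Max_in) (auto simp: paths_def)
    then show ?thesis
      by (auto simp: max_energy_def)
  qed
  then have "max_energy ` paths r s \<subseteq> range E"
    by blast
  then have fin: "finite (max_energy ` paths r s)"
    by (rule finite_subset) simp
  obtain \<gamma> where "\<gamma> \<in> paths r s" "max_energy \<gamma> = Min (max_energy ` paths r s)"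
    using Min_in[OF fin] paths_nonempty by fastforce
  then have "minimal_path r s \<gamma>"
    using fin by (simp add: minimal_path_def)
  then show ?thesis ..
qed

lemma essential_saddle_energy:
  assumes "r \<noteq> s"
  obtains \<gamma> where "minimal_path r s \<gamma>" "E (essential_saddle r s) = max_energy \<gamma>"
proof -
  obtain \<gamma> where \<gamma>: "minimal_path r s \<gamma>"
    using minimal_path_exists by blast
  then have "Max (E ` set \<gamma>) \<in> E ` set \<gamma>"
    by (intro Max_in) (auto simp: minimal_path_def paths_def)
  then obtain z where z: "z \<in> set \<gamma>" "E z = max_energy \<gamma>"
    by (auto simp: max_energy_def)
  have "essential_saddle r s = z"
    unfolding essential_saddle_def if_not_P[OF assms]
  proof (rule the_equality)
    fix z'
    assume "\<exists>\<gamma>'. minimal_path r s \<gamma>' \<and> z' \<in> set \<gamma>' \<and> E z' = max_energy \<gamma>'"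
    then obtain \<gamma>' where "minimal_path r s \<gamma>'" "E z' = max_energy \<gamma>'"
      by blast
    then have "E z' = E z"
      using \<gamma> z(2) unfolding minimal_path_def by (metis order_antisym)
    then show "z' = z"
      using inj_E by (simp add: inj_eq)
  qed (use \<gamma> z in blast)
  then show ?thesis
    using that \<gamma> z(2) by blast
qed

text \<open>The first step of a path that leaves a local minimum already goes uphill.\<close>

lemma local_minimum_below_saddle:
  assumes "m \<in> local_minima" "m \<noteq> s"
  shows "E m < E (essential_saddle m s)"
proof -
  obtain \<gamma> where \<gamma>: "minimal_path m s \<gamma>" "E (essential_saddle m s) = max_energy \<gamma>"
    using essential_saddle_energy[OF assms(2)] .
  then have path: "\<gamma> \<in> paths m s"
    by (simp add: minimal_path_def)
  then obtain r \<gamma>' where r: "\<gamma> = m # r # \<gamma>'"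
    using assms(2) by (cases \<gamma> rule: remdups_adj.cases) (auto simp: paths_def)
  then have "edge m r" "m \<noteq> r"
    using path by (auto simp: paths_def)
  then have "neighbour r m"
    using support_sym[of 1] by (simp add: neighbour_def edge_iff)
  then have "E m < E r"
    using assms(1) by (simp add: local_minima_def)
  also have "E r \<le> max_energy \<gamma>"
    unfolding max_energy_def r by (intro Max_ge) auto
  finally show ?thesis
    by (simp add: \<gamma>(2))
qed

end

section \<open>Growth of the valleys\<close>

context metastable_filtration
begin

lemma metastable_states_subset: "1 \<le> i \<Longrightarrow> metastable_states i \<subseteq> local_minima"
  using lab_bij unfolding metastable_states_def bij_betw_def by auto

lemma metastable_states_1: "metastable_states 1 = local_minima"
  using lab_bij unfolding metastable_states_def bij_betw_def by simp

lemma local_minimum_in_valley: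
  assumes "m \<in> local_minima"
  shows "m \<in> valley 1 m"
proof -
  have refl: "essential_saddle m m = m"
    by (simp add: essential_saddle_def)
  have "Min ((\<lambda>m'. E (essential_saddle m m')) ` local_minima) = E m"
  proof (rule Min_eqI)
    fix e
    assume "e \<in> (\<lambda>m'. E (essential_saddle m m')) ` local_minima"
    then obtain m' where "e = E (essential_saddle m m')"
      by blast
    then show "E m \<le> e"
      using local_minimum_below_saddle[OF assms, of m'] refl by (cases "m' = m") auto
  next
    show "E m \<in> (\<lambda>m'. E (essential_saddle m m')) ` local_minima"
      using assms refl by (intro image_eqI[of _ _ m]) simp_all
  qed simp
  then have "attracted 1 m m"
    using local_minimum_below_saddle[OF assms] refl
    by (force simp: attracted_def metastable_states_1[unfolded One_nat_def])
  then show ?thesis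
    by (simp add: valley.simps)
qed

lemma valley_Suc_subset:
  assumes "1 \<le> k"
  shows "valley k m \<subseteq> valley (Suc k) m"
  using assms by (subst (2) valley.simps) auto

lemma valley_mono:
  assumes "1 \<le> j" "j \<le> k"
  shows "valley j m \<subseteq> valley k m"
  using assms(2)
proof (induction rule: dec_induct)
  case (step k)
  then show ?case
    using valley_Suc_subset[of k m] assms(1) by auto
qed simp

end

theorem proposition2p9:
  fixes E :: "'s::finite \<Rightarrow> real"
    and p :: "real \<Rightarrow> 's \<Rightarrow> 's \<Rightarrow> real"
    and \<pi> :: "real \<Rightarrow> 's \<Rightarrow> real"
    and n i :: nat and lab :: "nat \<Rightarrow> 's" and m :: 's and \<beta> :: real
  assumes "metastable_filtration E p \<pi> n lab"
    and "\<beta> > 0"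
    and "1 \<le> i" and "i \<le> n"
    and "m \<in> metastable_filtration.metastable_states n lab i"
  shows "mono_on {1..i}
    (\<lambda>j. perron_eigenvalue (p \<beta>) (metastable_filtration.valley E p n lab j m))"
proof -
  interpret metastable_filtration E p \<pi> n lab
    by (fact assms(1))
  interpret symmetrizable_nonneg "p \<beta>" "\<pi> \<beta>"
    by (rule symmetrizable_transitions) (fact assms(2))
  have "m \<in> valley 1 m"
    using assms(3,5) metastable_states_subset local_minimum_in_valley by blast
  then have nonempty: "valley j m \<noteq> {}" if "1 \<le> j" for j
    using valley_mono[of 1 j m] that by auto
  show ?thesis
  proof (rule mono_onI)
    fix j k
    assume "j \<in> {1..i}" "j \<le> k"
    then show "perron_eigenvalue (p \<beta>) (valley j m) \<le> perron_eigenvalue (p \<beta>) (valley k m)"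
      by (intro perron_eigenvalue_mono nonempty valley_mono) auto
  qed
qed

end
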